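(* Let $q\geq 3$ and $k$ be natural numbers and let $f:[q]^k\to\mathbb{N}$. There exist a graph $G_f$, a set of vertices $B=\{b_1,\dots,b_k\}\subseteq V(G_f)$ of size $k$, and lists $L_v\subseteq[q]$ for $v\in V(G_f)$, such that for every $\alpha\in[q]^k$ there are exactly $f(\alpha)$ list $q$-colorings $c$ of $G_f$ with $c(b_i)=\alpha(i)$ for all $i\in[k]$. Additionally, $|V(G_f)|\leq 20kq^{k+1}\max(f)$ and $G_f$ has cutwidth at most $6kq^{k+2}$.
   Context: $\mathbb{N}=\{1,2,\dots\}$ and $[q]=\{1,\dots,q\}$. A list $q$-coloring of a graph with lists $(L_v)$ is a map $c:V\to[q]$ with $c(v)\in L_v$ for all $v$ and $c(u)\neq c(v)$ for every edge $uv$. The cutwidth of a graph is the smallest $k$ such that its vertices can be ordered $v_1,\dots,v_n$ with at most $k$ edges between $\{v_1,\dots,v_i\}$ and $\{v_{i+1},\dots,v_n\}$ for each $i\in[n-1]$. *)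

theory Defs
  imports Main "HOL-Library.FuncSet"
begin

definition simple_graph :: "'a set \<Rightarrow> 'a set set \<Rightarrow> bool" where
  "simple_graph V E \<longleftrightarrow> finite V \<and> (\<forall>e\<in>E. \<exists>u\<in>V. \<exists>v\<in>V. u \<noteq> v \<and> e = {u, v})"

text \<open>Colorings are extensional functions on \<open>V\<close>, so that counting them counts maps with domain
  exactly \<open>V\<close>.\<close>

definition list_colorings ::
    "nat \<Rightarrow> 'a set \<Rightarrow> 'a set set \<Rightarrow> ('a \<Rightarrow> nat set) \<Rightarrow> ('a \<Rightarrow> nat) set" where
  "list_colorings q V E L =
     {c \<in> V \<rightarrow>\<^sub>E {1..q}. (\<forall>v\<in>V. c v \<in> L v) \<and> (\<forall>u v. {u, v} \<in> E \<longrightarrow> c u \<noteq> c v)}"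

definition cut_edges :: "'a set set \<Rightarrow> 'a set \<Rightarrow> 'a set \<Rightarrow> 'a set set" where
  "cut_edges E S T = {e \<in> E. \<exists>u\<in>S. \<exists>v\<in>T. e = {u, v}}"

definition cutwidth :: "'a set \<Rightarrow> 'a set set \<Rightarrow> nat" where
  "cutwidth V E = (LEAST w. \<exists>x. bij_betw x {1..card V} V \<and>
     (\<forall>i\<in>{1..<card V}. card (cut_edges E (x ` {1..i}) (x ` {Suc i..card V})) \<le> w))"

end

theory Submission
  imports Defs
begin

text \<open>
  For every \<open>\<beta>\<close> attach to \<open>B\<close> a gadget with exactly \<open>f \<beta>\<close> extensions of
  \<open>\<beta>\<close> and exactly one extension of every other colouring of \<open>B\<close>; the numbers of extensions multiply.

  Joining a vertex \<open>s\<close> to a clique of vertices \<open>w\<^sub>a\<close> with lists \<open>{a, d}\<close>, one for each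
  colour \<open>a \<noteq> d\<close> that \<open>s\<close> may take, forces the colours of all \<open>w\<^sub>a\<close>: \<open>w\<^sub>a\<close> gets \<open>d\<close> if \<open>s\<close> has
  colour \<open>a\<close>, and \<open>a\<close> otherwise. Composing such cliques gives, for every \<open>i\<close>, a vertex \<open>u\<^sub>i\<close>
  with colour 3 if \<open>b\<^sub>i\<close> has colour \<open>\<beta> i\<close>, and 1 otherwise. A path with lists
  \<open>{1,2}, {2,3}, {3,1}, {1,2}, \<dots>\<close> on \<open>m\<close> vertices has \<open>m + 1\<close> colourings, but only one if the
  colour 1 is forbidden at its first vertex; so join that vertex to all \<open>u\<^sub>i\<close> and take
  \<open>m = f \<beta> - 1\<close>. In the order of construction each cut contains at most one edge between
  consecutive vertices, and the number of all other edges does not depend on \<open>f\<close>.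
\<close>

section \<open>Counting extensions of a colouring vertex by vertex\<close>

text \<open>The vertices are \<open>0, 1, 2, \<dots>\<close> in the order of construction. An entry \<open>(N, L)\<close> of the second
  argument adds the next vertex, with list \<open>L\<close> and edges to the earlier vertices in \<open>N\<close>; the first
  argument lists the colours of the vertices already present.\<close>

fun num_ext :: "nat list \<Rightarrow> (nat set \<times> nat set) list \<Rightarrow> nat" where
  "num_ext cs [] = 1"
| "num_ext cs (g # gs) = (\<Sum>a\<in>snd g - (!) cs ` fst g. num_ext (cs @ [a]) gs)"

fun valid_ext :: "nat \<Rightarrow> nat \<Rightarrow> (nat set \<times> nat set) list \<Rightarrow> bool" where
  "valid_ext q n [] = True"
| "valid_ext q n (g # gs) = (fst g \<subseteq> {..<n} \<and> snd g \<subseteq> {1..q} \<and> valid_ext q (Suc n) gs)"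

text \<open>Counts the edges that do not join consecutive vertices.\<close>

fun long_edges :: "nat \<Rightarrow> (nat set \<times> nat set) list \<Rightarrow> nat" where
  "long_edges n [] = 0"
| "long_edges n (g # gs) = card (fst g - {n - 1}) + long_edges (Suc n) gs"

lemma valid_ext_append:
  "valid_ext q n (gs @ hs) \<longleftrightarrow> valid_ext q n gs \<and> valid_ext q (n + length gs) hs"
  by (induction gs arbitrary: n) auto

lemma long_edges_append:
  "long_edges n (gs @ hs) = long_edges n gs + long_edges (n + length gs) hs"
  by (induction gs arbitrary: n) auto

lemma valid_ext_nth:
  "valid_ext q n gs \<Longrightarrow> j < length gs \<Longrightarrow>
    fst (gs ! j) \<subseteq> {..<n + j} \<and> snd (gs ! j) \<subseteq> {1..q}"
proof (induction gs arbitrary: n j)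
  case (Cons g gs)
  show ?case
  proof (cases j)
    case 0
    then show ?thesis using Cons.prems by simp
  next
    case (Suc i)
    then show ?thesis using Cons.IH[of "Suc n" i] Cons.prems by simp
  qed
qed simp

lemma long_edges_eq_sum:
  "long_edges n gs = (\<Sum>j<length gs. card (fst (gs ! j) - {n + j - 1}))"
proof (induction gs arbitrary: n)
  case (Cons g gs)
  show ?case by (simp add: Cons sum.lessThan_Suc_shift del: sum.lessThan_Suc)
qed simp

lemma image_nth_append:
  "M \<subseteq> {..<length cs} \<Longrightarrow> (!) (cs @ xs) ` M = (!) cs ` M"
  by (rule image_cong) (auto simp: nth_append)

section \<open>Clique gates\<close>

text \<open>\<open>M\<close> accumulates the source and the clique vertices placed so far, so each
  new vertex is joined to all of them. The lemmas on \<open>num_ext\<close> below depend only on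
  which colours already occur on \<open>M\<close>.\<close>

fun clique_block :: "nat set \<Rightarrow> nat \<Rightarrow> nat \<Rightarrow> nat list \<Rightarrow> (nat set \<times> nat set) list" where
  "clique_block M n d [] = []"
| "clique_block M n d (a # as) = (M, {a, d}) # clique_block (insert n M) (Suc n) d as"

lemma length_clique_block [simp]: "length (clique_block M n d as) = length as"
  by (induction as arbitrary: M n) auto

lemma valid_clique_block:
  "M \<subseteq> {..<n} \<Longrightarrow> set as \<subseteq> {1..q} \<Longrightarrow> d \<in> {1..q} \<Longrightarrow> valid_ext q n (clique_block M n d as)"
proof (induction as arbitrary: M n)
  case (Cons a as)
  have "insert n M \<subseteq> {..<Suc n}" using Cons.prems by auto
  then show ?case using Cons by auto
qed simp

text \<open>The last vertex has the most earlier neighbours, at most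
  \<open>card M + length as - 1\<close>; this bound is charged to every vertex.\<close>

lemma long_edges_clique_block:
  "finite M \<Longrightarrow> long_edges n (clique_block M n d as) \<le> length as * (card M + length as - 1)"
proof (induction as arbitrary: M n)
  case (Cons a as)
  have "card (insert n M) \<le> Suc (card M)" by (rule card_insert_le_m1) (auto simp: card_insert_if)
  then have "length as * (card (insert n M) + length as - 1) \<le> length as * (card M + length as)"
    by (intro mult_le_mono2) linarith
  moreover have "card (M - {n - 1}) \<le> card M"
    by (rule card_mono) (use Cons.prems in auto)
  ultimately show ?case
    using Cons.IH[of "insert n M" "Suc n"] Cons.prems by (simp add: algebra_simps)
qed simp

text \<open>Once \<open>d\<close> is taken, each vertex with list \<open>{a, d}\<close> must take
  its own colour \<open>a\<close>, and distinctness keeps \<open>a\<close> free.\<close>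

lemma num_ext_clique_used:
  assumes "M \<subseteq> {..<length cs}" "distinct as" "d \<notin> set as" "d \<in> (!) cs ` M"
    "(!) cs ` M \<inter> set as = {}"
  shows "num_ext cs (clique_block M (length cs) d as @ hs) = num_ext (cs @ as) hs"
  using assms
proof (induction as arbitrary: M cs)
  case (Cons a as)
  have *: "{a, d} - (!) cs ` M = {a}" using Cons.prems by auto
  have im: "(!) (cs @ [a]) ` insert (length cs) M = insert a ((!) cs ` M)"
    using Cons.prems(1) by (simp add: image_nth_append)
  have "num_ext (cs @ [a]) (clique_block (insert (length cs) M) (length (cs @ [a])) d as @ hs)
     = num_ext ((cs @ [a]) @ as) hs"
  proof (rule Cons.IH)
    show "insert (length cs) M \<subseteq> {..<length (cs @ [a])}" using Cons.prems(1) by auto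
  qed (unfold im, use Cons.prems in auto)
  then show ?case by (simp add: *)
qed simp

text \<open>Whatever happens before it, the vertex with list \<open>{e, d}\<close> finds both of its
  colours taken.\<close>

lemma num_ext_clique_dead:
  assumes "M \<subseteq> {..<length cs}" "e \<in> set as" "{d, e} \<subseteq> (!) cs ` M"
  shows "num_ext cs (clique_block M (length cs) d as @ hs) = 0"
  using assms
proof (induction as arbitrary: M cs)
  case (Cons a as)
  show ?case
  proof (cases "a = e")
    case True
    then have "{a, d} - (!) cs ` M = {}" using Cons.prems by auto
    then show ?thesis by (simp del: Diff_eq_empty_iff)
  next
    case False
    have "num_ext (cs @ [x]) (clique_block (insert (length cs) M) (length (cs @ [x])) d as @ hs) = 0"
      for x
    proof (rule Cons.IH)
      show "insert (length cs) M \<subseteq> {..<length (cs @ [x])}" using Cons.prems(1) by auto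
      show "e \<in> set as" using Cons.prems False by auto
      show "{d, e} \<subseteq> (!) (cs @ [x]) ` insert (length cs) M"
        using Cons.prems by (simp add: image_nth_append)
    qed
    then show ?thesis by simp
  qed
qed simp

text \<open>The vertex for \<open>e\<close> is forced to take \<open>d\<close>. A vertex before it
  cannot take \<open>d\<close>, since this would block the vertex for \<open>e\<close>; the vertices
  after it find \<open>d\<close> already taken.\<close>

lemma num_ext_clique_hit:
  assumes "M \<subseteq> {..<length cs}" "distinct as" "d \<notin> set as" "d \<notin> (!) cs ` M"
    "e \<in> set as" "(!) cs ` M \<inter> set as = {e}"
  shows "num_ext cs (clique_block M (length cs) d as @ hs)
    = num_ext (cs @ map (\<lambda>a. if a = e then d else a) as) hs"
  using assms
proof (induction as arbitrary: M cs)
  case (Cons a as)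
  have sub: "insert (length cs) M \<subseteq> {..<length (cs @ [x])}" for x using Cons.prems(1) by auto
  have im: "(!) (cs @ [x]) ` insert (length cs) M = insert x ((!) cs ` M)" for x
    using Cons.prems(1) by (simp add: image_nth_append)
  show ?case
  proof (cases "a = e")
    case True
    have *: "{a, d} - (!) cs ` M = {d}" using Cons.prems True by auto
    have "num_ext (cs @ [d]) (clique_block (insert (length cs) M) (length (cs @ [d])) d as @ hs)
       = num_ext ((cs @ [d]) @ as) hs"
      by (rule num_ext_clique_used[OF sub]) (unfold im, use Cons.prems True in auto)
    moreover have "map (\<lambda>a. if a = e then d else a) as = as"
      by (rule map_idI) (use Cons.prems True in auto)
    ultimately show ?thesis using True * by simp
  next
    case False
    have *: "{a, d} - (!) cs ` M = {a, d}" using Cons.prems False by auto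
    have 1: "num_ext (cs @ [d]) (clique_block (insert (length cs) M) (length (cs @ [d])) d as @ hs) = 0"
      by (rule num_ext_clique_dead[OF sub, of e]) (unfold im, use Cons.prems False in auto)
    have 2: "num_ext (cs @ [a]) (clique_block (insert (length cs) M) (length (cs @ [a])) d as @ hs)
       = num_ext ((cs @ [a]) @ map (\<lambda>a. if a = e then d else a) as) hs"
      by (rule Cons.IH[OF sub]) (unfold im, use Cons.prems False in auto)
    have "a \<noteq> d" using Cons.prems by auto
    then show ?thesis using 1 2 * False by simp
  qed
qed simp

text \<open>The new vertices \<open>gs\<close> are coloured in exactly one way whenever the source \<open>s\<close> has a colour in
  \<open>S\<close>, and then the \<open>p\<close>-th of them has the colour \<open>h\<close> of the colour of \<open>s\<close>.\<close>

definition gate ::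
    "nat \<Rightarrow> nat \<Rightarrow> nat set \<Rightarrow> nat \<Rightarrow> (nat \<Rightarrow> nat) \<Rightarrow> (nat set \<times> nat set) list \<Rightarrow> nat \<Rightarrow> bool" where
  "gate q n S s h gs p \<longleftrightarrow> valid_ext q n gs \<and> p < length gs \<and>
     (\<forall>cs. length cs = n \<longrightarrow> cs ! s \<in> S \<longrightarrow>
       (\<exists>ws. length ws = length gs \<and> ws ! p = h (cs ! s) \<and>
         (\<forall>hs. num_ext cs (gs @ hs) = num_ext (cs @ ws) hs)))"

text \<open>Source colour \<open>d\<close> is the used case, every other one the hit case; the
  output is the first clique vertex. A source colour outside \<open>d # e # as\<close> would leave
  \<open>d\<close> free and the colouring ambiguous, hence the condition on
  \<open>S\<close>.\<close>

lemma gate_clique: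
  assumes "s < n" "distinct (e # as)" "d \<notin> set (e # as)" "set (d # e # as) \<subseteq> {1..q}"
    "S \<subseteq> set (d # e # as)"
  shows "gate q n S s (\<lambda>x. if x = e then d else e) (clique_block {s} n d (e # as)) 0"
  unfolding gate_def
proof (intro conjI allI impI)
  show "valid_ext q n (clique_block {s} n d (e # as))"
    by (rule valid_clique_block) (use assms in auto)
  fix cs :: "nat list"
  assume cs: "length cs = n" "cs ! s \<in> S"
  define ws where "ws = map (\<lambda>a. if a = cs ! s then d else a) (e # as)"
  have "num_ext cs (clique_block {s} n d (e # as) @ hs) = num_ext (cs @ ws) hs" for hs
  proof (cases "cs ! s = d")
    case True
    then have "ws = e # as" unfolding ws_def by (intro map_idI) (use assms in auto)
    then show ?thesis
      using num_ext_clique_used[of "{s}" cs "e # as" d hs] True cs assms by simp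
  next
    case False
    then show ?thesis unfolding ws_def
      using num_ext_clique_hit[of "{s}" cs "e # as" d "cs ! s" hs] cs assms by auto
  qed
  then show "\<exists>ws. length ws = length (clique_block {s} n d (e # as)) \<and>
      ws ! 0 = (if cs ! s = e then d else e) \<and>
      (\<forall>hs. num_ext cs (clique_block {s} n d (e # as) @ hs) = num_ext (cs @ ws) hs)"
    by (intro exI[of _ ws]) (auto simp: ws_def)
qed simp

lemma gate_comp:
  assumes 1: "gate q n S s h gs p" and 2: "gate q (n + length gs) S' (n + p) h' gs' p'"
    and "h ` S \<subseteq> S'"
  shows "gate q n S s (h' \<circ> h) (gs @ gs') (length gs + p')"
  unfolding gate_def
proof (intro conjI allI impI)
  show "valid_ext q n (gs @ gs')" "length gs + p' < length (gs @ gs')"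
    using 1 2 by (auto simp: gate_def valid_ext_append)
  fix cs :: "nat list"
  assume cs: "length cs = n" "cs ! s \<in> S"
  then obtain ws where ws: "length ws = length gs" "ws ! p = h (cs ! s)"
      "\<And>hs. num_ext cs (gs @ hs) = num_ext (cs @ ws) hs"
    using 1 unfolding gate_def by blast
  have nth: "(cs @ ws) ! (n + p) = h (cs ! s)" using ws cs by (simp add: nth_append)
  have "length (cs @ ws) = n + length gs" "(cs @ ws) ! (n + p) \<in> S'"
    using nth ws cs assms(3) by auto
  then obtain ws' where ws': "length ws' = length gs'" "ws' ! p' = h' ((cs @ ws) ! (n + p))"
      "\<And>hs. num_ext (cs @ ws) (gs' @ hs) = num_ext ((cs @ ws) @ ws') hs"
    using 2 unfolding gate_def by blast
  show "\<exists>ws. length ws = length (gs @ gs') \<and> ws ! (length gs + p') = (h' \<circ> h) (cs ! s) \<and>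
      (\<forall>hs. num_ext cs ((gs @ gs') @ hs) = num_ext (cs @ ws) hs)"
    by (intro exI[of _ "ws @ ws'"]) (use ws ws' nth in \<open>auto simp: nth_append\<close>)
qed

lemma gate_cong:
  "gate q n S s h gs p \<Longrightarrow> (\<And>x. x \<in> S \<Longrightarrow> h x = h' x) \<Longrightarrow> gate q n S s h' gs p"
  unfolding gate_def by metis

text \<open>One clique can only output \<open>d\<close> or \<open>e\<close>, so the wanted colours 3
  and 1 are reached by composition: at once for \<open>e = 1\<close>, after one exchange of 1 and 3
  for \<open>e = 3\<close>, and through one more clique otherwise.\<close>

lemma indicator_gate:
  assumes q: "q \<ge> 3" and e: "e \<in> {1..q}" and s: "s < n"
  obtains gs p where "gate q n {1..q} s (\<lambda>x. if x = e then 3 else 1) gs p"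
    "length gs \<le> q + 2" "long_edges n gs \<le> q\<^sup>2"
proof -
  define rest where "rest d = sorted_list_of_set ({1..q} - {d, e})" for d
  have rest: "set (rest d) = {1..q} - {d, e}" "distinct (rest d)" for d
    by (simp_all add: rest_def)
  have len: "length (rest d) = q - 2" if "d \<noteq> e" "d \<in> {1..q}" for d
    using that e by (simp add: rest_def card_Diff_subset)
  define C where "C d = clique_block {s} n d (e # rest d)" for d
  have C: "gate q n {1..q} s (\<lambda>x. if x = e then d else e) (C d) 0"
    if "d \<noteq> e" "d \<in> {1..q}" for d
    unfolding C_def by (rule gate_clique) (use that e s rest in auto)
  have lenC: "length (C d) = q - 1" if "d \<noteq> e" "d \<in> {1..q}" for d
    using that q by (simp add: C_def len)
  \<comment> \<open>The slack 4 pays for the gates composed after \<open>C d\<close>: at most 3 long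
    edges in the two-vertex clique \<open>D\<close> below and 1 in the exchange.\<close>
  have longC: "long_edges n (C d) + 4 \<le> q\<^sup>2" if "d \<noteq> e" "d \<in> {1..q}" for d
  proof -
    have "long_edges n (C d) \<le> (q - 1) * (1 + (q - 1) - 1)"
      using long_edges_clique_block[of "{s}" n d "e # rest d"] lenC[OF that]
      unfolding C_def length_clique_block by (simp only: card.insert finite.intros) simp
    then have "long_edges n (C d) \<le> (q - 1) * (q - 1)" by simp
    moreover have "(q - 1) * (q - 1) + 4 \<le> q\<^sup>2"
    proof -
      obtain m where "q = 3 + m" using le_Suc_ex[OF q] by blast
      then show ?thesis by (simp add: power2_eq_square algebra_simps)
    qed
    ultimately show ?thesis by linarith
  qed
  \<comment> \<open>The one-vertex clique exchanges the colours 1 and 3.\<close>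
  have swap: "gate q m {1, 3} t (\<lambda>x. if x = 1 then 3 else 1) (clique_block {t} m 3 [1]) 0"
    if "t < m" for t m
    by (rule gate_clique) (use that q in auto)
  have long_swap: "long_edges m (clique_block {t} m 3 [1]) \<le> 1" for t m
    using long_edges_clique_block[of "{t}" m 3 "[1]"] by simp
  consider "e = 1" | "e = 3" | "e \<noteq> 1" "e \<noteq> 3" by blast
  then show thesis
  proof cases
    case 1
    have d: "3 \<noteq> e" "3 \<in> {1..q}" using 1 q by auto
    have "gate q n {1..q} s (\<lambda>x. if x = e then 3 else 1) (C 3) 0"
      using C[OF d] unfolding 1 .
    moreover have "length (C 3) \<le> q + 2" "long_edges n (C 3) \<le> q\<^sup>2"
      using lenC[OF d] longC[OF d] by linarith+
    ultimately show thesis by (rule that)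
  next
    case 2
    have d: "1 \<noteq> e" "1 \<in> {1..q}" using 2 q by auto
    have "gate q n {1..q} s ((\<lambda>x. if x = 1 then 3 else 1) \<circ> (\<lambda>x. if x = e then 1 else e))
        (C 1 @ clique_block {n + 0} (n + length (C 1)) 3 [1]) (length (C 1) + 0)"
      by (rule gate_comp[OF C[OF d] swap]) (use 2 q lenC[OF d] in auto)
    then have "gate q n {1..q} s (\<lambda>x. if x = e then 3 else 1)
        (C 1 @ clique_block {n + 0} (n + length (C 1)) 3 [1]) (length (C 1) + 0)"
      by (rule gate_cong) (use 2 in auto)
    moreover have "length (C 1 @ clique_block {n + 0} (n + length (C 1)) 3 [1]) \<le> q + 2"
      using lenC[OF d] by simp
    moreover have "long_edges n (C 1 @ clique_block {n + 0} (n + length (C 1)) 3 [1]) \<le> q\<^sup>2"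
      using longC[OF d] long_swap[of "n + length (C 1)" "n + 0"]
      unfolding long_edges_append by linarith
    ultimately show thesis by (rule that)
  next
    case 3
    have d: "3 \<noteq> e" "3 \<in> {1..q}" using 3 q by auto
    \<comment> \<open>The output of \<open>C 3\<close> is 3 on a match and \<open>e\<close>
      otherwise. \<open>D\<close> turns these into 1 and 3, and the final exchange into 3 and
      1.\<close>
    define D where "D = clique_block {n + 0} (n + length (C 3)) 1 [3, e]"
    have D: "gate q (n + length (C 3)) {e, 3} (n + 0) (\<lambda>x. if x = 3 then 1 else 3) D 0"
      unfolding D_def by (rule gate_clique) (use 3 q e lenC[OF d] in auto)
    have CD: "gate q n {1..q} s ((\<lambda>x. if x = 3 then 1 else 3) \<circ> (\<lambda>x. if x = e then 3 else e))
        (C 3 @ D) (length (C 3) + 0)"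
      by (rule gate_comp[OF C[OF d] D]) auto
    let ?p = "n + (length (C 3) + 0)" and ?m = "n + length (C 3 @ D)"
    have lD: "length D = 2" by (simp add: D_def)
    have "gate q n {1..q} s
        ((\<lambda>x. if x = 1 then 3 else 1) \<circ> ((\<lambda>x. if x = 3 then 1 else 3 :: nat) \<circ> (\<lambda>x. if x = e then 3 else e)))
        ((C 3 @ D) @ clique_block {?p} ?m 3 [1]) (length (C 3 @ D) + 0)"
      by (rule gate_comp[OF CD swap]) (use lD in auto)
    then have "gate q n {1..q} s (\<lambda>x. if x = e then 3 else 1)
        ((C 3 @ D) @ clique_block {?p} ?m 3 [1]) (length (C 3 @ D) + 0)"
      by (rule gate_cong) (use 3 in auto)
    moreover have "length ((C 3 @ D) @ clique_block {?p} ?m 3 [1]) \<le> q + 2"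
      using lenC[OF d] lD q by simp
    moreover have "long_edges n ((C 3 @ D) @ clique_block {?p} ?m 3 [1]) \<le> q\<^sup>2"
    proof -
      have "long_edges (n + length (C 3)) D \<le> 3"
        by (auto simp: D_def card_insert_if insert_Diff_if)
      then show ?thesis
        using longC[OF d] long_swap[of ?m ?p] unfolding long_edges_append by linarith
    qed
    ultimately show thesis by (rule that)
  qed
qed

text \<open>One indicator gate per boundary vertex; \<open>P\<close> collects their outputs. A
  mismatch anywhere shows up as colour 1 on \<open>P\<close>, while colour 2 never occurs there and
  stays available to a common neighbour. The start \<open>n\<close> is arbitrary so that blocks can
  be stacked.\<close>

lemma match_block:
  assumes q: "q \<ge> 3" and \<beta>: "\<And>i. i < k \<Longrightarrow> \<beta> i \<in> {1..q}" and "k \<le> n" and "j \<le> k"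
  shows "\<exists>gs P. valid_ext q n gs \<and> P \<subseteq> {..<n + length gs} \<and> card P \<le> j \<and>
    length gs \<le> j * (q + 2) \<and> long_edges n gs \<le> j * q\<^sup>2 \<and>
    (\<forall>cs. length cs = n \<longrightarrow> (\<forall>i<k. cs ! i \<in> {1..q}) \<longrightarrow>
      (\<exists>ws. length ws = length gs \<and> (!) (cs @ ws) ` P \<subseteq> {1, 3} \<and>
        (1 \<notin> (!) (cs @ ws) ` P \<longleftrightarrow> (\<forall>i<j. cs ! i = \<beta> i)) \<and>
        (\<forall>hs. num_ext cs (gs @ hs) = num_ext (cs @ ws) hs)))"
  using \<open>j \<le> k\<close>
proof (induction j)
  case 0
  show ?case by (intro exI[of _ "[]"] exI[of _ "{}"]) auto
next
  case (Suc j)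
  then obtain gs P where gs: "valid_ext q n gs" "P \<subseteq> {..<n + length gs}" "card P \<le> j"
    "length gs \<le> j * (q + 2)" "long_edges n gs \<le> j * q\<^sup>2" and
    ext: "\<And>cs. length cs = n \<Longrightarrow> (\<forall>i<k. cs ! i \<in> {1..q}) \<Longrightarrow>
      (\<exists>ws. length ws = length gs \<and> (!) (cs @ ws) ` P \<subseteq> {1, 3} \<and>
        (1 \<notin> (!) (cs @ ws) ` P \<longleftrightarrow> (\<forall>i<j. cs ! i = \<beta> i)) \<and>
        (\<forall>hs. num_ext cs (gs @ hs) = num_ext (cs @ ws) hs))"
    by auto
  have "j < n + length gs" using Suc.prems assms(3) by auto
  with indicator_gate[OF q \<beta>] Suc.prems obtain hs p where
    hs: "gate q (n + length gs) {1..q} j (\<lambda>x. if x = \<beta> j then 3 else 1) hs p"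
    "length hs \<le> q + 2" "long_edges (n + length gs) hs \<le> q\<^sup>2"
    by (metis Suc_le_lessD)
  have p: "p < length hs" and vh: "valid_ext q (n + length gs) hs"
    using hs(1) by (auto simp: gate_def)
  \<comment> \<open>The added vertex is the output of the new gate, which starts at
    \<open>n + length gs\<close>.\<close>
  let ?P = "insert (n + length gs + p) P"
  show ?case
  proof (intro exI[of _ "gs @ hs"] exI[of _ ?P] conjI allI impI)
    show "valid_ext q n (gs @ hs)" using gs vh by (simp add: valid_ext_append)
    show "?P \<subseteq> {..<n + length (gs @ hs)}" using gs(2) p by auto
    show "card ?P \<le> Suc j"
      using gs(3) finite_subset[OF gs(2)] by (simp add: card_insert_if)
    show "length (gs @ hs) \<le> Suc j * (q + 2)" using gs(4) hs(2) by simp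
    show "long_edges n (gs @ hs) \<le> Suc j * q\<^sup>2"
      using gs(5) hs(3) by (simp add: long_edges_append)
    fix cs :: "nat list"
    assume cs: "length cs = n" "\<forall>i<k. cs ! i \<in> {1..q}"
    obtain ws where ws: "length ws = length gs" "(!) (cs @ ws) ` P \<subseteq> {1, 3}"
        "1 \<notin> (!) (cs @ ws) ` P \<longleftrightarrow> (\<forall>i<j. cs ! i = \<beta> i)"
        "\<And>hs. num_ext cs (gs @ hs) = num_ext (cs @ ws) hs"
      using ext[OF cs] by blast
    have j: "(cs @ ws) ! j = cs ! j" using Suc.prems assms(3) cs by (simp add: nth_append)
    then have "length (cs @ ws) = n + length gs" "(cs @ ws) ! j \<in> {1..q}"
      using cs ws Suc.prems by auto
    then obtain vs where vs: "length vs = length hs"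
        "vs ! p = (if (cs @ ws) ! j = \<beta> j then 3 else 1)"
        "\<And>hs'. num_ext (cs @ ws) (hs @ hs') = num_ext ((cs @ ws) @ vs) hs'"
      using hs(1) unfolding gate_def by blast
    have "(!) ((cs @ ws) @ vs) ` P = (!) (cs @ ws) ` P"
      by (rule image_nth_append) (use gs(2) cs ws in auto)
    moreover have "((cs @ ws) @ vs) ! (n + length gs + p) = vs ! p"
      using cs ws by (metis \<open>length (cs @ ws) = n + length gs\<close> nth_append_length_plus)
    ultimately have im: "(!) (cs @ (ws @ vs)) ` ?P
        = insert (if cs ! j = \<beta> j then 3 else 1) ((!) (cs @ ws) ` P)"
      using vs j by simp
    show "\<exists>ws. length ws = length (gs @ hs) \<and> (!) (cs @ ws) ` ?P \<subseteq> {1, 3} \<and>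
        (1 \<notin> (!) (cs @ ws) ` ?P \<longleftrightarrow> (\<forall>i<Suc j. cs ! i = \<beta> i)) \<and>
        (\<forall>hs'. num_ext cs ((gs @ hs) @ hs') = num_ext (cs @ ws) hs')"
    proof (intro exI[of _ "ws @ vs"] conjI)
      show "(!) (cs @ (ws @ vs)) ` ?P \<subseteq> {1, 3}" unfolding im using ws(2) by auto
      show "1 \<notin> (!) (cs @ (ws @ vs)) ` ?P \<longleftrightarrow> (\<forall>i<Suc j. cs ! i = \<beta> i)"
        unfolding im using ws(3) by (auto simp: less_Suc_eq)
    qed (use ws vs in auto)
  qed
qed

section \<open>Counting paths\<close>

definition cyc :: "nat \<Rightarrow> nat" where
  "cyc j = Suc (j mod 3)"

text \<open>Hence the lists \<open>{cyc j, cyc (Suc j)}\<close> of adjacent path vertices share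
  exactly one colour.\<close>

lemma cyc_neq: "cyc j \<noteq> cyc (Suc j)" "cyc j \<noteq> cyc (Suc (Suc j))" "cyc (Suc j) \<noteq> cyc j"
  unfolding cyc_def by presburger+

lemma cyc_bounds: "Suc 0 \<le> cyc j" "q \<ge> 3 \<Longrightarrow> cyc j \<le> q"
proof -
  have "j mod 3 < 3" by simp
  then show "Suc 0 \<le> cyc j" "q \<ge> 3 \<Longrightarrow> cyc j \<le> q" unfolding cyc_def by linarith+
qed

text \<open>Read the colour \<open>cyc (Suc j)\<close> of the \<open>j\<close>-th vertex as ``true'': the only constraint
  along the path is then that truth propagates forward.\<close>

fun chain :: "nat \<Rightarrow> nat \<Rightarrow> nat \<Rightarrow> (nat set \<times> nat set) list" where
  "chain n j 0 = []"
| "chain n j (Suc m) = ({n - 1}, {cyc j, cyc (Suc j)}) # chain (Suc n) (Suc j) m"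

lemma length_chain [simp]: "length (chain n j m) = m"
  by (induction m arbitrary: n j) auto

lemma valid_chain: "q \<ge> 3 \<Longrightarrow> n > 0 \<Longrightarrow> valid_ext q n (chain n j m)"
  by (induction m arbitrary: n j) (auto simp: cyc_bounds)

lemma long_edges_chain: "long_edges n (chain n j m) = 0"
  by (induction m arbitrary: n j) auto

text \<open>The vertex before the chain is true, so every chain vertex is forced to be true. The
  hypothesis on \<open>X\<close> says that the rest is blind to the colours of the chain.\<close>

lemma num_ext_chain_true:
  assumes "cs \<noteq> []" "last cs = cyc j" "\<And>ys. length ys = m \<Longrightarrow> num_ext (cs @ ys) hs = X"
  shows "num_ext cs (chain (length cs) j m @ hs) = X"
  using assms
proof (induction m arbitrary: j cs)
  case 0
  then show ?case using "0.prems"(3)[of "[]"] by simp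
next
  case (Suc m)
  have *: "{cyc j, cyc (Suc j)} - {cs ! (length cs - Suc 0)} = {cyc (Suc j)}"
    using Suc.prems cyc_neq by (auto simp: last_conv_nth)
  have "num_ext (cs @ [cyc (Suc j)]) (chain (length (cs @ [cyc (Suc j)])) (Suc j) m @ hs) = X"
  proof (rule Suc.IH)
    fix ys :: "nat list" assume "length ys = m"
    then show "num_ext ((cs @ [cyc (Suc j)]) @ ys) hs = X"
      using Suc.prems(3)[of "cyc (Suc j) # ys"] by simp
  qed auto
  then show ?case by (simp add: *)
qed

text \<open>Truth may begin at any of the \<open>m\<close> vertices or never, which gives
  \<open>m + 1\<close> colourings. In the induction, \<open>cyc (Suc j)\<close> leads to the true
  case and \<open>cyc j\<close> to the induction hypothesis.\<close>

lemma num_ext_chain_false: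
  assumes "cs \<noteq> []" "last cs \<notin> {cyc j, cyc (Suc j)}"
    "\<And>ys. length ys = m \<Longrightarrow> num_ext (cs @ ys) hs = X"
  shows "num_ext cs (chain (length cs) j m @ hs) = Suc m * X"
  using assms
proof (induction m arbitrary: j cs)
  case 0
  then show ?case using "0.prems"(3)[of "[]"] by simp
next
  case (Suc m)
  have *: "{cyc j, cyc (Suc j)} - {cs ! (length cs - Suc 0)} = {cyc j, cyc (Suc j)}"
    using Suc.prems by (auto simp: last_conv_nth)
  have X: "num_ext ((cs @ [a]) @ ys) hs = X" if "length ys = m" for a ys
    using Suc.prems(3)[of "a # ys"] that by simp
  have "num_ext (cs @ [cyc (Suc j)]) (chain (length (cs @ [cyc (Suc j)])) (Suc j) m @ hs) = X"
    by (rule num_ext_chain_true) (use X in auto)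
  moreover have "num_ext (cs @ [cyc j]) (chain (length (cs @ [cyc j])) (Suc j) m @ hs) = Suc m * X"
    by (rule Suc.IH) (use X cyc_neq in auto)
  ultimately show ?case by (simp add: * cyc_neq)
qed

section \<open>Gadgets that multiply the number of extensions\<close>

lemma point_gadget:
  assumes q: "q \<ge> 3" and \<beta>: "\<And>i. i < k \<Longrightarrow> \<beta> i \<in> {1..q}" and "k \<le> n"
  shows "\<exists>gs. valid_ext q n gs \<and> length gs \<le> k * (q + 2) + m \<and> long_edges n gs \<le> k * q\<^sup>2 + k \<and>
    (\<forall>cs hs X. length cs = n \<longrightarrow> (\<forall>i<k. cs ! i \<in> {1..q}) \<longrightarrow>
      (\<forall>ys. length ys = length gs \<longrightarrow> num_ext (cs @ ys) hs = X) \<longrightarrow>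
      num_ext cs (gs @ hs) = (if \<forall>i<k. cs ! i = \<beta> i then Suc m else 1) * X)"
proof (cases m)
  case 0
  show ?thesis by (intro exI[of _ "[]"]) (auto simp: 0)
next
  case (Suc m')
  obtain gs P where gs: "valid_ext q n gs" "P \<subseteq> {..<n + length gs}" "card P \<le> k"
    "length gs \<le> k * (q + 2)" "long_edges n gs \<le> k * q\<^sup>2" and
    ext: "\<And>cs. length cs = n \<Longrightarrow> (\<forall>i<k. cs ! i \<in> {1..q}) \<Longrightarrow>
      (\<exists>ws. length ws = length gs \<and> (!) (cs @ ws) ` P \<subseteq> {1, 3} \<and>
        (1 \<notin> (!) (cs @ ws) ` P \<longleftrightarrow> (\<forall>i<k. cs ! i = \<beta> i)) \<and>
        (\<forall>hs. num_ext cs (gs @ hs) = num_ext (cs @ ws) hs))"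
    using match_block[of q k \<beta> n k, OF q \<beta> \<open>k \<le> n\<close> order_refl] by blast
  define N where "N = n + length gs"
  \<comment> \<open>The vertex \<open>N\<close> with list \<open>{1, 2}\<close>, which is
    \<open>{cyc 0, cyc 1}\<close>, starts the path and is the one joined to \<open>P\<close>; the
    chain therefore continues at index 1, and the path has \<open>Suc m' = m\<close>
    vertices.\<close>
  define G where "G = gs @ (P, {1, 2}) # chain (Suc N) 1 m'"
  have fP: "finite P" using gs(2) finite_subset by blast
  show ?thesis
  proof (intro exI[of _ G] conjI allI impI)
    show "valid_ext q n G"
      unfolding G_def using gs q by (auto simp: valid_ext_append N_def intro: valid_chain)
    show "length G \<le> k * (q + 2) + m" unfolding G_def using gs Suc by simp
    \<comment> \<open>The edges from \<open>P\<close> to the first path vertex account for the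
      additional \<open>k\<close>; the chain has no long edges.\<close>
    have "card (P - {N - 1}) \<le> card P" by (rule card_mono) (use fP in auto)
    then show "long_edges n G \<le> k * q\<^sup>2 + k"
      unfolding G_def using gs long_edges_chain[of "Suc N" 1 m']
      by (simp add: long_edges_append N_def)
    fix cs hs X
    assume cs: "length cs = n" "\<forall>i<k. cs ! i \<in> {1..q}"
      and X: "\<forall>ys. length ys = length G \<longrightarrow> num_ext (cs @ ys) hs = X"
    obtain ws where ws: "length ws = length gs" "(!) (cs @ ws) ` P \<subseteq> {1, 3}"
        "1 \<notin> (!) (cs @ ws) ` P \<longleftrightarrow> (\<forall>i<k. cs ! i = \<beta> i)"
        "\<And>hs. num_ext cs (gs @ hs) = num_ext (cs @ ws) hs"
      using ext[OF cs] by blast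
    have len: "length (cs @ ws @ [a]) = Suc N" for a using cs ws by (simp add: N_def)
    have X': "num_ext ((cs @ ws @ [a]) @ ys) hs = X" if "length ys = m'" for a ys
      using X[rule_format, of "ws @ a # ys"] that ws by (simp add: G_def)
    have c: "cyc (Suc 0) = 2" "cyc (Suc (Suc 0)) = 3" by (simp_all add: cyc_def)
    \<comment> \<open>At the first path vertex, colour 2 is true and forces the rest, while colour 1
      is false and leaves \<open>m\<close> colourings. A match allows both, giving
      \<open>m + 1\<close>; a mismatch allows only 2.\<close>
    have t: "num_ext (cs @ ws @ [2]) (chain (Suc N) 1 m' @ hs) = X"
      unfolding len[symmetric, of 2] by (rule num_ext_chain_true) (use X' c in auto)
    have f: "num_ext (cs @ ws @ [1]) (chain (Suc N) 1 m' @ hs) = m * X"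
      unfolding len[symmetric, of 1] Suc
      by (rule num_ext_chain_false) (use X' c in auto)
    have *: "num_ext cs (G @ hs)
        = (\<Sum>a\<in>{1, 2} - (!) (cs @ ws) ` P. num_ext (cs @ ws @ [a]) (chain (Suc N) 1 m' @ hs))"
      by (simp add: G_def ws(4))
    show "num_ext cs (G @ hs) = (if \<forall>i<k. cs ! i = \<beta> i then Suc m else 1) * X"
    proof (cases "\<forall>i<k. cs ! i = \<beta> i")
      case True
      then have "{1, 2} - (!) (cs @ ws) ` P = {1, 2}" using ws(2,3) by auto
      then show ?thesis unfolding * using t f True by simp
    next
      case False
      then have "{1, 2} - (!) (cs @ ws) ` P = {2}" using ws(2,3) by auto
      then show ?thesis unfolding * using t by (simp only: False if_False) simp
    qed
  qed
qed

text \<open>The gadgets are stacked one after another. Each reads only the first \<open>k\<close>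
  vertices, so there are no constraints between different gadgets and the numbers of extensions
  multiply.\<close>

lemma product_gadget:
  assumes q: "q \<ge> 3" and \<beta>: "\<And>\<beta> i. \<beta> \<in> set bs \<Longrightarrow> i < k \<Longrightarrow> \<beta> i \<in> {1..q}" and "k \<le> n"
    and m: "\<And>\<beta>. \<beta> \<in> set bs \<Longrightarrow> m \<beta> \<le> B"
  shows "\<exists>gs. valid_ext q n gs \<and> length gs \<le> length bs * (k * (q + 2) + B) \<and>
    long_edges n gs \<le> length bs * (k * q\<^sup>2 + k) \<and>
    (\<forall>cs. length cs = n \<longrightarrow> (\<forall>i<k. cs ! i \<in> {1..q}) \<longrightarrow>
      num_ext cs gs = (\<Prod>\<beta>\<leftarrow>bs. if \<forall>i<k. cs ! i = \<beta> i then Suc (m \<beta>) else 1))"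
  using \<open>k \<le> n\<close> \<beta> m
proof (induction bs arbitrary: n)
  case Nil
  show ?case by (intro exI[of _ "[]"]) auto
next
  case (Cons \<beta> bs)
  obtain gs where gs: "valid_ext q n gs" "length gs \<le> k * (q + 2) + m \<beta>"
    "long_edges n gs \<le> k * q\<^sup>2 + k" and
    ext: "\<And>cs hs X. length cs = n \<Longrightarrow> (\<forall>i<k. cs ! i \<in> {1..q}) \<Longrightarrow>
      (\<forall>ys. length ys = length gs \<longrightarrow> num_ext (cs @ ys) hs = X) \<Longrightarrow>
      num_ext cs (gs @ hs) = (if \<forall>i<k. cs ! i = \<beta> i then Suc (m \<beta>) else 1) * X"
    using point_gadget[OF q _ \<open>k \<le> n\<close>, of \<beta> "m \<beta>"] Cons.prems(2)[of \<beta>] by auto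
  have "\<exists>hs. valid_ext q (n + length gs) hs \<and> length hs \<le> length bs * (k * (q + 2) + B) \<and>
    long_edges (n + length gs) hs \<le> length bs * (k * q\<^sup>2 + k) \<and>
    (\<forall>cs. length cs = n + length gs \<longrightarrow> (\<forall>i<k. cs ! i \<in> {1..q}) \<longrightarrow>
      num_ext cs hs = (\<Prod>\<beta>\<leftarrow>bs. if \<forall>i<k. cs ! i = \<beta> i then Suc (m \<beta>) else 1))"
    by (rule Cons.IH) (use Cons.prems in auto)
  then obtain hs where hs: "valid_ext q (n + length gs) hs"
    "length hs \<le> length bs * (k * (q + 2) + B)"
    "long_edges (n + length gs) hs \<le> length bs * (k * q\<^sup>2 + k)"
    "\<And>cs. length cs = n + length gs \<Longrightarrow> (\<forall>i<k. cs ! i \<in> {1..q}) \<Longrightarrow>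
      num_ext cs hs = (\<Prod>\<beta>\<leftarrow>bs. if \<forall>i<k. cs ! i = \<beta> i then Suc (m \<beta>) else 1)"
    by blast
  show ?case
  proof (intro exI[of _ "gs @ hs"] conjI allI impI)
    show "valid_ext q n (gs @ hs)" using gs hs by (simp add: valid_ext_append)
    show "length (gs @ hs) \<le> length (\<beta> # bs) * (k * (q + 2) + B)"
      using gs(2) hs(2) Cons.prems(3)[of \<beta>] by simp
    show "long_edges n (gs @ hs) \<le> length (\<beta> # bs) * (k * q\<^sup>2 + k)"
      using gs hs by (simp add: long_edges_append)
    fix cs :: "nat list"
    assume cs: "length cs = n" "\<forall>i<k. cs ! i \<in> {1..q}"
    let ?X = "\<Prod>\<beta>\<leftarrow>bs. if \<forall>i<k. cs ! i = \<beta> i then Suc (m \<beta>) else 1"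
    \<comment> \<open>The remaining gadgets see only the boundary colours, so their count is
      constant over all colourings \<open>ys\<close> of the current gadget.\<close>
    have "num_ext (cs @ ys) hs = ?X" if "length ys = length gs" for ys
    proof -
      have nth: "(cs @ ys) ! i = cs ! i" if "i < k" for i
        using that cs Cons.prems(1) by (simp add: nth_append)
      have "num_ext (cs @ ys) hs
          = (\<Prod>\<beta>\<leftarrow>bs. if \<forall>i<k. (cs @ ys) ! i = \<beta> i then Suc (m \<beta>) else 1)"
        by (rule hs(4)) (use cs that nth in auto)
      then show ?thesis using nth by (simp cong: if_cong)
    qed
    then show "num_ext cs (gs @ hs)
        = (\<Prod>\<beta>\<leftarrow>\<beta> # bs. if \<forall>i<k. cs ! i = \<beta> i then Suc (m \<beta>) else 1)"
      using ext[OF cs, of hs ?X] by simp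
  qed
qed

section \<open>The graph of a list of extensions\<close>

text \<open>A bridge between \<open>num_ext\<close> and \<open>list_colorings\<close>: constraints
  are indexed by entries, and the prefix is fixed to \<open>cs\<close>, which suits an induction on
  \<open>gs\<close>.\<close>

definition ext_colorings :: "nat \<Rightarrow> nat list \<Rightarrow> (nat set \<times> nat set) list \<Rightarrow> (nat \<Rightarrow> nat) set" where
  "ext_colorings q cs gs = {c \<in> {..<length cs + length gs} \<rightarrow>\<^sub>E {1..q}.
     (\<forall>v<length cs. c v = cs ! v) \<and>
     (\<forall>j<length gs. c (length cs + j) \<in> snd (gs ! j) \<and>
        (\<forall>u\<in>fst (gs ! j). c u \<noteq> c (length cs + j)))}"

lemma finite_ext_colorings: "finite (ext_colorings q cs gs)"
  unfolding ext_colorings_def by (rule finite_subset[of _ "{..<length cs + length gs} \<rightarrow>\<^sub>E {1..q}"])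
    (auto intro: finite_PiE)

text \<open>The colourings are partitioned by the colour \<open>a\<close> of the first new vertex;
  fixing it moves that vertex into the prefix, matching the recursion of
  \<open>num_ext\<close>.\<close>

lemma card_ext_colorings:
  "valid_ext q (length cs) gs \<Longrightarrow> set cs \<subseteq> {1..q} \<Longrightarrow>
    card (ext_colorings q cs gs) = num_ext cs gs"
proof (induction gs arbitrary: cs)
  case Nil
  have "ext_colorings q cs [] = {\<lambda>v\<in>{..<length cs}. cs ! v}"
    using Nil.prems(2) by (auto simp: ext_colorings_def PiE_def extensional_def fun_eq_iff subset_iff)
  then show ?case by simp
next
  case (Cons g gs)
  let ?A = "snd g - (!) cs ` fst g"
  have A: "?A \<subseteq> {1..q}" using Cons.prems by auto
  have "ext_colorings q cs (g # gs) = (\<Union>a\<in>?A. ext_colorings q (cs @ [a]) gs)"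
  proof (intro set_eqI iffI)
    fix c assume c: "c \<in> ext_colorings q cs (g # gs)"
    let ?a = "c (length cs)"
    have "?a \<in> snd g" "\<forall>u\<in>fst g. c u \<noteq> ?a" "\<forall>v<length cs. c v = cs ! v"
      using c unfolding ext_colorings_def by force+
    then have a: "?a \<in> ?A" using Cons.prems(1) by (auto simp: subset_iff)
    have "c \<in> ext_colorings q (cs @ [?a]) gs"
      unfolding ext_colorings_def
    proof (intro CollectI conjI allI impI ballI)
      show "c \<in> {..<length (cs @ [?a]) + length gs} \<rightarrow>\<^sub>E {1..q}"
        using c by (simp add: ext_colorings_def)
      show "c v = (cs @ [?a]) ! v" if "v < length (cs @ [?a])" for v
        using c that by (auto simp: ext_colorings_def nth_append less_Suc_eq)
      fix j assume "j < length gs"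
      then have "Suc j < length (g # gs)" by simp
      then have *: "c (length cs + Suc j) \<in> snd ((g # gs) ! Suc j) \<and>
          (\<forall>u\<in>fst ((g # gs) ! Suc j). c u \<noteq> c (length cs + Suc j))"
        using c unfolding ext_colorings_def by blast
      show "c (length (cs @ [?a]) + j) \<in> snd (gs ! j)" using * by simp
      show "c u \<noteq> c (length (cs @ [?a]) + j)" if "u \<in> fst (gs ! j)" for u using * that by simp
    qed
    with a show "c \<in> (\<Union>a\<in>?A. ext_colorings q (cs @ [a]) gs)" by blast
  next
    fix c assume "c \<in> (\<Union>a\<in>?A. ext_colorings q (cs @ [a]) gs)"
    then obtain a where a: "a \<in> ?A" and c: "c \<in> ext_colorings q (cs @ [a]) gs" by blast
    have pre: "c v = (cs @ [a]) ! v" if "v \<le> length cs" for v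
      using c that by (simp add: ext_colorings_def)
    have [simp]: "c (length cs) = a" using pre[of "length cs"] by simp
    have pre': "c v = cs ! v" if "v < length cs" for v
      using pre[of v] that by (simp add: nth_append)
    show "c \<in> ext_colorings q cs (g # gs)"
      unfolding ext_colorings_def
    proof (intro CollectI conjI allI impI)
      show "c \<in> {..<length cs + length (g # gs)} \<rightarrow>\<^sub>E {1..q}"
        using c by (simp add: ext_colorings_def)
      show "c v = cs ! v" if "v < length cs" for v by (rule pre'[OF that])
      fix j assume j: "j < length (g # gs)"
      have "c (length cs + j) \<in> snd ((g # gs) ! j) \<and>
          (\<forall>u\<in>fst ((g # gs) ! j). c u \<noteq> c (length cs + j))"
      proof (cases j)
        case 0
        have "c u \<noteq> a" if "u \<in> fst g" for u
        proof -
          have "u < length cs" using that Cons.prems(1) by auto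
          then show ?thesis using pre'[of u] a that by auto
        qed
        then show ?thesis using a 0 by simp
      next
        case (Suc i)
        then show ?thesis using c j by (simp add: ext_colorings_def)
      qed
      then show "c (length cs + j) \<in> snd ((g # gs) ! j)"
        "\<forall>u\<in>fst ((g # gs) ! j). c u \<noteq> c (length cs + j)" by blast+
    qed
  qed
  moreover have "card (\<Union>a\<in>?A. ext_colorings q (cs @ [a]) gs)
      = (\<Sum>a\<in>?A. card (ext_colorings q (cs @ [a]) gs))"
  proof (rule card_UN_disjoint)
    show "finite ?A" using A finite_subset by blast
    show "\<forall>a\<in>?A. finite (ext_colorings q (cs @ [a]) gs)" by (simp add: finite_ext_colorings)
    have "c (length cs) = a" if "c \<in> ext_colorings q (cs @ [a]) gs" for a c
      using that by (simp add: ext_colorings_def)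
    then show "\<forall>a\<in>?A. \<forall>b\<in>?A. a \<noteq> b \<longrightarrow>
        ext_colorings q (cs @ [a]) gs \<inter> ext_colorings q (cs @ [b]) gs = {}" by blast
  qed
  moreover have "card (ext_colorings q (cs @ [a]) gs) = num_ext (cs @ [a]) gs" if "a \<in> ?A" for a
    by (rule Cons.IH) (use that A Cons.prems in auto)
  ultimately show ?case by simp
qed

definition ext_edges :: "nat \<Rightarrow> (nat set \<times> nat set) list \<Rightarrow> nat set set" where
  "ext_edges k gs = {{u, k + j} |u j. j < length gs \<and> u \<in> fst (gs ! j)}"

definition ext_lists :: "nat \<Rightarrow> nat \<Rightarrow> (nat set \<times> nat set) list \<Rightarrow> nat \<Rightarrow> nat set" where
  "ext_lists q k gs v = (if v < k then {1..q} else snd (gs ! (v - k)))"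

lemma list_colorings_ext:
  assumes "valid_ext q k gs" "length cs = k"
  shows "{c \<in> list_colorings q {..<k + length gs} (ext_edges k gs) (ext_lists q k gs).
      \<forall>v<k. c v = cs ! v} = ext_colorings q cs gs"
proof (intro set_eqI iffI)
  fix c assume "c \<in> {c \<in> list_colorings q {..<k + length gs} (ext_edges k gs) (ext_lists q k gs).
      \<forall>v<k. c v = cs ! v}"
  then have c: "c \<in> {..<k + length gs} \<rightarrow>\<^sub>E {1..q}"
    "\<And>v. v < k + length gs \<Longrightarrow> c v \<in> ext_lists q k gs v"
    "\<And>u v. {u, v} \<in> ext_edges k gs \<Longrightarrow> c u \<noteq> c v" "\<And>v. v < k \<Longrightarrow> c v = cs ! v"
    by (auto simp: list_colorings_def)
  show "c \<in> ext_colorings q cs gs"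
    unfolding ext_colorings_def
  proof (intro CollectI conjI allI impI ballI)
    fix j assume j: "j < length gs"
    show "c (length cs + j) \<in> snd (gs ! j)"
      using c(2)[of "k + j"] j assms by (simp add: ext_lists_def)
    show "c u \<noteq> c (length cs + j)" if "u \<in> fst (gs ! j)" for u
      using c(3)[of u "k + j"] j that assms by (auto simp: ext_edges_def)
  qed (use c assms in auto)
next
  fix c assume c: "c \<in> ext_colorings q cs gs"
  then have c1: "c \<in> {..<k + length gs} \<rightarrow>\<^sub>E {1..q}" and c2: "\<And>v. v < k \<Longrightarrow> c v = cs ! v"
    and c3: "\<And>j. j < length gs \<Longrightarrow> c (k + j) \<in> snd (gs ! j)"
    and c4: "\<And>j u. j < length gs \<Longrightarrow> u \<in> fst (gs ! j) \<Longrightarrow> c u \<noteq> c (k + j)"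
    using assms by (auto simp: ext_colorings_def)
  have "c v \<in> ext_lists q k gs v" if "v < k + length gs" for v
  proof (cases "v < k")
    case True
    then show ?thesis using PiE_mem[OF c1, of v] by (simp add: ext_lists_def)
  next
    case False
    then have "v - k < length gs" "k + (v - k) = v" using that by auto
    then show ?thesis using c3[of "v - k"] False by (simp add: ext_lists_def)
  qed
  moreover have "c u \<noteq> c v" if "{u, v} \<in> ext_edges k gs" for u v
  proof -
    obtain w j where "{u, v} = {w, k + j}" "j < length gs" "w \<in> fst (gs ! j)"
      using \<open>{u, v} \<in> ext_edges k gs\<close> unfolding ext_edges_def
      by (elim CollectE exE conjE) (rule that)
    then show ?thesis using c4[of j w] by (auto simp: doubleton_eq_iff)
  qed
  ultimately show "c \<in> {c \<in> list_colorings q {..<k + length gs} (ext_edges k gs) (ext_lists q k gs).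
      \<forall>v<k. c v = cs ! v}"
    using c1 c2 by (auto simp: list_colorings_def)
qed

lemma simple_graph_ext:
  assumes "valid_ext q k gs"
  shows "simple_graph {..<k + length gs} (ext_edges k gs)"
  unfolding simple_graph_def ext_edges_def
proof (intro conjI ballI)
  fix e assume "e \<in> {{u, k + j} |u j. j < length gs \<and> u \<in> fst (gs ! j)}"
  then obtain u j where uj: "e = {u, k + j}" "j < length gs" "u \<in> fst (gs ! j)" by blast
  with valid_ext_nth[OF assms uj(2)] have "u < k + j" by auto
  with uj show "\<exists>u\<in>{..<k + length gs}. \<exists>v\<in>{..<k + length gs}. u \<noteq> v \<and> e = {u, v}"
    by (intro bexI[of _ u] bexI[of _ "k + j"]) auto
qed simp

text \<open>In the order of construction a cut is crossed by at most one edge between consecutive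
  vertices; all other crossing edges are long, and all long edges together are charged to every
  cut.\<close>

lemma cutwidth_ext:
  assumes "valid_ext q k gs"
  shows "cutwidth {..<k + length gs} (ext_edges k gs) \<le> Suc (long_edges k gs)"
proof -
  \<comment> \<open>Positions start at 1 and vertices at 0, so position \<open>i\<close> holds
    vertex \<open>i - 1\<close>.\<close>
  let ?n = "k + length gs" and ?x = "\<lambda>i::nat. i - 1"
  \<comment> \<open>\<open>F j\<close> consists of the long edges contributed by entry
    \<open>j\<close>.\<close>
  define F where "F j = (\<lambda>u. {u, k + j}) ` (fst (gs ! j) - {k + j - 1})" for j
  have fin: "finite (fst (gs ! j))" if "j < length gs" for j
    using valid_ext_nth[OF assms that] finite_subset by blast
  have "card (\<Union>j<length gs. F j) \<le> (\<Sum>j<length gs. card (F j))"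
    by (rule card_UN_le) simp
  also have "\<dots> \<le> long_edges k gs"
    unfolding long_edges_eq_sum F_def by (rule sum_mono) (auto intro: card_image_le simp: fin)
  finally have F: "card (\<Union>j<length gs. F j) \<le> long_edges k gs" .
  have finF: "finite (\<Union>j<length gs. F j)" by (auto simp: F_def fin)
  have "card (cut_edges (ext_edges k gs) (?x ` {1..i}) (?x ` {Suc i..?n})) \<le> Suc (long_edges k gs)"
    (is "card ?C \<le> _") if "i \<in> {1..<?n}" for i
  proof -
    have "?C \<subseteq> insert {i - 1, i} (\<Union>j<length gs. F j)"
    proof
      fix e assume "e \<in> ?C"
      then obtain a b where e: "e \<in> ext_edges k gs" "e = {a, b}"
        and "a \<in> ?x ` {1..i}" "b \<in> ?x ` {Suc i..?n}"
        by (auto simp: cut_edges_def)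
      then have ab: "a < i" "i \<le> b" by auto
      obtain u j where uj: "e = {u, k + j}" "j < length gs" "u \<in> fst (gs ! j)"
        using e by (auto simp: ext_edges_def)
      with valid_ext_nth[OF assms uj(2)] have "u < k + j" by auto
      then have u: "u = a" "k + j = b" using ab e(2) uj(1) by (auto simp: doubleton_eq_iff)
      show "e \<in> insert {i - 1, i} (\<Union>j<length gs. F j)"
      proof (cases "u = k + j - 1")
        case True
        then have "a = i - 1" "b = i" using u ab by auto
        then show ?thesis using e by simp
      next
        case False
        then show ?thesis using uj by (auto simp: F_def)
      qed
    qed
    then have "card ?C \<le> card (insert {i - 1, i} (\<Union>j<length gs. F j))"
      by (rule card_mono[rotated]) (use finF in simp)
    also have "\<dots> \<le> Suc (card (\<Union>j<length gs. F j))"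
      using finF by (simp add: card_insert_if)
    finally show ?thesis using F by simp
  qed
  moreover have "bij_betw ?x {1..?n} {..<?n}"
    by (rule bij_betw_byWitness[of _ Suc]) auto
  ultimately show ?thesis
    unfolding cutwidth_def by (intro Least_le) (auto intro!: exI[of _ ?x])
qed

section \<open>The graph and lists for \<open>f\<close>\<close>

theorem theorem14:
  fixes q k :: nat and f :: "(nat \<Rightarrow> nat) \<Rightarrow> nat"
  assumes "q \<ge> 3" and "k \<ge> 1"
    and "\<And>\<alpha>. \<alpha> \<in> {1..k} \<rightarrow>\<^sub>E {1..q} \<Longrightarrow> f \<alpha> \<ge> 1"
  shows "\<exists>(V :: nat set) E b L.
    simple_graph V E \<and>
    b ` {1..k} \<subseteq> V \<and> inj_on b {1..k} \<and>
    (\<forall>v\<in>V. L v \<subseteq> {1..q}) \<and>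
    (\<forall>\<alpha> \<in> {1..k} \<rightarrow>\<^sub>E {1..q}.
       card {c \<in> list_colorings q V E L. \<forall>i\<in>{1..k}. c (b i) = \<alpha> i} = f \<alpha>) \<and>
    card V \<le> 20 * k * q ^ (k + 1) * Max (f ` ({1..k} \<rightarrow>\<^sub>E {1..q})) \<and>
    cutwidth V E \<le> 6 * k * q ^ (k + 2)"
proof -
  let ?A = "{1..k} \<rightarrow>\<^sub>E {1..q}"
  define M where "M = Max (f ` ?A)"
  have finA: "finite ?A" by (simp add: finite_PiE)
  have cardA: "card ?A = q ^ k" by (simp add: card_PiE)
  have fM: "f \<alpha> \<le> M" if "\<alpha> \<in> ?A" for \<alpha>
    unfolding M_def using that finA by simp
  obtain as where as: "set as = ?A" "distinct as" using finite_distinct_list[OF finA] by blast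
  have las: "length as = q ^ k" using as cardA distinct_card by metis
  have "?A \<noteq> {}" using \<open>q \<ge> 3\<close> by (auto simp: PiE_eq_empty_iff)
  then obtain \<alpha> where "\<alpha> \<in> ?A" by blast
  then have M: "M \<ge> 1" using order_trans[OF assms(3) fM] by blast
  \<comment> \<open>The boundary vertices are \<open>0, ..., k - 1\<close>, whereas the arguments of
    \<open>f\<close> are indexed by \<open>{1..k}\<close>.\<close>
  define shift :: "(nat \<Rightarrow> nat) \<Rightarrow> nat \<Rightarrow> nat" where "shift \<alpha> i = \<alpha> (Suc i)" for \<alpha> i
  have shift_inj: "\<alpha> = \<beta>" if "\<alpha> \<in> ?A" "\<beta> \<in> ?A" "\<forall>i<k. shift \<alpha> i = shift \<beta> i" for \<alpha> \<beta>
  proof (rule PiE_ext[OF that(1,2)])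
    fix i assume "i \<in> {1..k}"
    then have "i - 1 < k" "Suc (i - 1) = i" by auto
    then show "\<alpha> i = \<beta> i" using that(3) unfolding shift_def by metis
  qed
  have inj: "inj_on shift ?A" by (rule inj_onI) (rule shift_inj, auto)
  \<comment> \<open>A matching gadget contributes the factor \<open>Suc (m \<beta>)\<close>, which
    is the value of \<open>f\<close> because that value is at least 1.\<close>
  define m where "m \<beta> = f (the_inv_into ?A shift \<beta>) - 1" for \<beta>
  have m: "m (shift \<alpha>) = f \<alpha> - 1" if "\<alpha> \<in> ?A" for \<alpha>
    unfolding m_def using the_inv_into_f_f[OF inj that] by simp
  have "\<exists>gs. valid_ext q k gs \<and> length gs \<le> length (map shift as) * (k * (q + 2) + (M - 1)) \<and>
    long_edges k gs \<le> length (map shift as) * (k * q\<^sup>2 + k) \<and>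
    (\<forall>cs. length cs = k \<longrightarrow> (\<forall>i<k. cs ! i \<in> {1..q}) \<longrightarrow>
      num_ext cs gs = (\<Prod>\<beta>\<leftarrow>map shift as. if \<forall>i<k. cs ! i = \<beta> i then Suc (m \<beta>) else 1))"
  proof (rule product_gadget)
    show "\<beta> i \<in> {1..q}" if "\<beta> \<in> set (map shift as)" "i < k" for \<beta> i
    proof -
      obtain \<alpha> where \<alpha>: "\<alpha> \<in> ?A" "\<beta> = shift \<alpha>" using \<open>\<beta> \<in> set (map shift as)\<close> as by auto
      show ?thesis unfolding \<alpha>(2) shift_def by (rule PiE_mem[OF \<alpha>(1)]) (use \<open>i < k\<close> in auto)
    qed
    show "m \<beta> \<le> M - 1" if "\<beta> \<in> set (map shift as)" for \<beta>
    proof -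
      obtain \<alpha> where \<alpha>: "\<alpha> \<in> ?A" "\<beta> = shift \<alpha>" using \<open>\<beta> \<in> set (map shift as)\<close> as by auto
      show ?thesis unfolding \<alpha>(2) m[OF \<alpha>(1)] by (rule diff_le_mono[OF fM[OF \<alpha>(1)]])
    qed
  qed (use assms in auto)
  then obtain gs where gs: "valid_ext q k gs"
    "length gs \<le> q ^ k * (k * (q + 2) + (M - 1))" "long_edges k gs \<le> q ^ k * (k * q\<^sup>2 + k)"
    "\<And>cs. length cs = k \<Longrightarrow> (\<forall>i<k. cs ! i \<in> {1..q}) \<Longrightarrow>
      num_ext cs gs = (\<Prod>\<beta>\<leftarrow>map shift as. if \<forall>i<k. cs ! i = \<beta> i then Suc (m \<beta>) else 1)"
    using las by auto
  let ?V = "{..<k + length gs}" and ?E = "ext_edges k gs" and ?L = "ext_lists q k gs"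
    and ?b = "\<lambda>i::nat. i - 1"
  have count: "card {c \<in> list_colorings q ?V ?E ?L. \<forall>i\<in>{1..k}. c (?b i) = \<alpha> i} = f \<alpha>"
    if \<alpha>: "\<alpha> \<in> ?A" for \<alpha>
  proof -
    define cs where "cs = map (shift \<alpha>) [0..<k]"
    have cs: "length cs = k" "\<And>i. i < k \<Longrightarrow> cs ! i = shift \<alpha> i" by (simp_all add: cs_def)
    have mem: "shift \<alpha> i \<in> {1..q}" if "i < k" for i
      unfolding shift_def by (rule PiE_mem[OF \<alpha>]) (use that in auto)
    have "(\<forall>i\<in>{1..k}. c (?b i) = \<alpha> i) \<longleftrightarrow> (\<forall>v<k. c v = cs ! v)" for c :: "nat \<Rightarrow> nat"
    proof
      assume h: "\<forall>i\<in>{1..k}. c (?b i) = \<alpha> i"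
      show "\<forall>v<k. c v = cs ! v"
        using h[rule_format, of "Suc _"] by (auto simp: cs shift_def)
    next
      assume h: "\<forall>v<k. c v = cs ! v"
      show "\<forall>i\<in>{1..k}. c (?b i) = \<alpha> i" using h by (auto simp: cs shift_def)
    qed
    then have "card {c \<in> list_colorings q ?V ?E ?L. \<forall>i\<in>{1..k}. c (?b i) = \<alpha> i}
        = card (ext_colorings q cs gs)"
      using list_colorings_ext[OF gs(1) cs(1)] by simp
    also have "\<dots> = num_ext cs gs"
      by (rule card_ext_colorings) (use gs cs mem in \<open>auto simp: cs_def\<close>)
    also have "\<dots> = (\<Prod>\<beta>\<leftarrow>map shift as. if \<forall>i<k. cs ! i = \<beta> i then Suc (m \<beta>) else 1)"
      by (rule gs(4)) (use cs mem in auto)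
    also have "\<dots> = (\<Prod>\<beta>\<in>?A. if \<forall>i<k. cs ! i = shift \<beta> i then Suc (m (shift \<beta>)) else 1)"
      using as by (simp add: prod.distinct_set_conv_list[symmetric] comp_def)
    \<comment> \<open>By injectivity of \<open>shift\<close>, only the gadget of
      \<open>\<alpha>\<close> itself matches; all others contribute 1.\<close>
    also have "\<dots> = (\<Prod>\<beta>\<in>?A. if \<beta> = \<alpha> then f \<alpha> else 1)"
    proof (rule prod.cong)
      fix \<beta> assume \<beta>: "\<beta> \<in> ?A"
      have "(\<forall>i<k. cs ! i = shift \<beta> i) \<longleftrightarrow> \<beta> = \<alpha>"
        using shift_inj[OF \<alpha> \<beta>] cs by auto
      then show "(if \<forall>i<k. cs ! i = shift \<beta> i then Suc (m (shift \<beta>)) else 1)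
          = (if \<beta> = \<alpha> then f \<alpha> else 1)"
        using m[OF \<alpha>] assms(3)[OF \<alpha>] by auto
    qed simp
    also have "\<dots> = f \<alpha>" using finA \<alpha> by simp
    finally show ?thesis .
  qed
  have size: "card ?V \<le> 20 * k * q ^ (k + 1) * M"
  proof -
    \<comment> \<open>The summands bound \<open>k * q\<close>, \<open>2 * k\<close> and
      \<open>M - 1\<close> in turn. Over \<open>q ^ k\<close> gadgets this gives the factor 4, and
      the \<open>k\<close> boundary vertices raise it to 5.\<close>
    have "k * (q + 2) + (M - 1) \<le> k * q * M + 2 * (k * q * M) + k * q * M"
    proof -
      have "k * q * 1 \<le> k * q * M" by (rule mult_le_mono2[OF M])
      moreover have "k * 1 \<le> k * q" by (rule mult_le_mono2) (use assms in auto)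
      moreover have "1 * M \<le> k * q * M" by (rule mult_le_mono1) (use assms in auto)
      ultimately show ?thesis unfolding distrib_left by linarith
    qed
    then have "length gs \<le> q ^ k * (4 * (k * q * M))"
      by (intro order_trans[OF gs(2)] mult_le_mono2) linarith
    then have "length gs \<le> 4 * (k * (q ^ (k + 1) * M))" by (simp add: mult_ac)
    moreover have "k * 1 \<le> k * (q ^ (k + 1) * M)"
      by (rule mult_le_mono2) (use M assms in auto)
    ultimately have "k + length gs \<le> 5 * (k * (q ^ (k + 1) * M))"
      by linarith
    also have "\<dots> \<le> 20 * k * q ^ (k + 1) * M" by (simp add: mult_ac)
    finally show ?thesis by simp
  qed
  have cut: "cutwidth ?V ?E \<le> 6 * k * q ^ (k + 2)"
  proof -
    \<comment> \<open>Each gadget has at most \<open>2 * k * q\<^sup>2\<close> long edges, so the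
      total is at most \<open>2 * k * q ^ (k + 2)\<close>; the one consecutive edge per cut still
      fits below the factor 6.\<close>
    have "k * 1 \<le> k * q\<^sup>2" by (rule mult_le_mono2) (use assms in auto)
    then have "long_edges k gs \<le> q ^ k * (2 * (k * q\<^sup>2))"
      by (intro order_trans[OF gs(3)] mult_le_mono2) linarith
    then have "long_edges k gs \<le> 2 * (k * q ^ (k + 2))" by (simp add: power2_eq_square mult_ac)
    moreover have "1 \<le> k * q ^ (k + 2)" using assms by auto
    ultimately show ?thesis
      using cutwidth_ext[OF gs(1)] unfolding mult.assoc by linarith
  qed
  show ?thesis
  proof (intro exI[of _ ?V] exI[of _ ?E] exI[of _ ?b] exI[of _ ?L] conjI ballI)
    show "simple_graph ?V ?E" by (rule simple_graph_ext[OF gs(1)])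
    show "inj_on ?b {1..k}" by (auto simp: inj_on_def)
    show "?L v \<subseteq> {1..q}" if "v \<in> ?V" for v
      using valid_ext_nth[OF gs(1), of "v - k"] that by (auto simp: ext_lists_def)
  qed (use count size cut in \<open>auto simp: M_def\<close>)
qed

end
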